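(* Let $D$ be a dataset of $n$ two-dimensional tuples in general position and let $r\ge1$ be an integer. The algorithm 2DRRM, run on $(D,r)$, returns an optimal solution of the RRM problem, i.e. a set $S\subseteq D$ with $|S|\le r$ and $\nabla_{\mathbb{L}}(S)=\min\{\nabla_{\mathbb{L}}(S'): \emptyset\ne S'\subseteq D,\ |S'|\le r\}$.
   Context: A ($2$-dimensional) dataset $D$ is a set of $n$ distinct tuples in $[0,1]^2$ such that for each attribute $i\in\{1,2\}$ some $t\in D$ has $t[i]=1$. $\mathbb{L}=\{u\in\mathbb{R}^2: u[1],u[2]\ge0\}$. The utility of $t$ for $u$ is $w(u,t)=u[1]t[1]+u[2]t[2]$. The rank $\nabla_u(t)$ is one plus the number of $t'\in D$ with $w(u,t')>w(u,t)$; $\nabla_u(S)=\min_{t\in S}\nabla_u(t)$; $\nabla_{\mathbb{L}}(S)=\max_{u\in\mathbb{L}}\nabla_u(S)$. $\mathrm{Sky}(D)$ is the set of $t\in D$ for which there is no $t'\in D$ with $w(u,t')\ge w(u,t)$ for all $u\in\mathbb{L}$ and $w(v,t')>w(v,t)$ for some $v\in\mathbb{L}$. Dual lines: each $t\in D$ is mapped to the line $y=t[1]x+t[2](1-x)$, considered for $x\in[0,1]$. General position: no two tuples agree in an attribute, and no three of the dual lines meet in a common point with $0\le x\le 1$. Algorithm 2DRRM on $(D,r)$: 1. Sort the tuples by second attribute in descending order, giving lines $l_1,\dots,l_n$ (ordered top to bottom at $x=0$). Compute $\mathrm{Sky}(D)$; the lines of skyline tuples ("skyline lines") are $l_{g(1)},\dots,l_{g(s)}$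 with $g(1)<\dots<g(s)$. Initialize the ordered list $L=(l_1,\dots,l_n)$; $\mathrm{Rank}(l)$ denotes the current position of $l$ in $L$. 2. Let $H$ be a priority queue (a balanced binary search tree, so that duplicates are not inserted) of intersections $(l_i,l_j)$ keyed by $x$-coordinate. For each $i\in\{1,\dots,n-1\}$, if $l_i,l_{i+1}$ intersect at some $x\in(0,1)$, insert $(l_i,l_{i+1})$ in $H$. 3. $M$ is an $s\times r$ matrix; each cell stores a sequence of skyline lines and a number. For all $i\in\{1,\dots,s\}$, $j\in\{1,\dots,r\}$ set $M[i,j]=(l_{g(i)})$ and $M[i,j].rank=\mathrm{Rank}(l_{g(i)})$. By convention $M[i,0].rank=+\infty$. 4. While $H$ is nonempty: remove the intersection $(l_i,l_j)$ with smallest $x$-coordinate $c$, where $l_i$ is the line immediately above $l_j$ in $L$; swap $l_i$ and $l_j$ in $L$. Let $l_q$ be the line now immediately above $l_j$ and $l_p$ the line now immediately below $l_i$ (if they exist). If $(l_q,l_j)$ has $x$-coordinate in $(c,1)$, insert it in $H$ (unless already present); likewise for $(l_i,l_p)$. If $l_i$ is a skyline line, $i=g(i')$, then for $h=r,r-1,\dots,1$ in this order: (a) set $M[i',h].rank=\max(M[i',h].rank,\mathrm{Rank}(l_i))$ (with the rank after the swap); (b) if $l_j$ is also a skyline line, $j=g(j')$, and $M[j',h].rank>M[i',h-1].rank$, set $M[j',h].rank=M[i',h-1].rank$ and let $M[j',h]$ be $M[i',h-1]$ with $l_j$ appended. 5. Choose $i\in\{1,\dots,s\}$ with $M[i,r].rank$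 minimal and return the set of tuples whose lines occur in $M[i,r]$. *)

theory Defs
  imports "HOL-Analysis.Analysis" "HOL-Combinatorics.Transposition"
begin

type_synonym tuple = "real ^ 2"

definition dataset :: "tuple set \<Rightarrow> bool" where
  "dataset D \<longleftrightarrow> finite D \<and> (\<forall>t\<in>D. \<forall>i. t $ i \<in> {0..1}) \<and> (\<forall>i. \<exists>t\<in>D. t $ i = 1)"

definition utilities :: "(real ^ 2) set" where
  "utilities = {u. \<forall>i. u $ i \<ge> 0}"

definition utility :: "real ^ 2 \<Rightarrow> tuple \<Rightarrow> real" where
  "utility u t = u $ 1 * t $ 1 + u $ 2 * t $ 2"

definition tuple_rank :: "tuple set \<Rightarrow> real ^ 2 \<Rightarrow> tuple \<Rightarrow> nat" where
  "tuple_rank D u t = 1 + card {t'\<in>D. utility u t' > utility u t}"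

definition set_rank :: "tuple set \<Rightarrow> real ^ 2 \<Rightarrow> tuple set \<Rightarrow> nat" where
  "set_rank D u S = (MIN t\<in>S. tuple_rank D u t)"

text \<open>For finite \<open>D\<close> and nonempty \<open>S \<subseteq> D\<close> the ranks lie in \<open>{1..card D}\<close>, so the maximum over the
  infinite set of utility vectors is the maximum of a finite nonempty set of numbers.\<close>

definition rank_regret :: "tuple set \<Rightarrow> tuple set \<Rightarrow> nat" where
  "rank_regret D S = (MAX u\<in>utilities. set_rank D u S)"

definition skyline :: "tuple set \<Rightarrow> tuple set" where
  "skyline D = {t\<in>D. \<not> (\<exists>t'\<in>D. (\<forall>u\<in>utilities. utility u t' \<ge> utility u t) \<and>
                                  (\<exists>v\<in>utilities. utility v t' > utility v t))}"

text \<open>The rank of the empty set is undefined, hence the requirement that a solution be nonempty.\<close>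

definition rrm_optimal :: "tuple set \<Rightarrow> nat \<Rightarrow> tuple set \<Rightarrow> bool" where
  "rrm_optimal D r S \<longleftrightarrow> S \<noteq> {} \<and> S \<subseteq> D \<and> card S \<le> r \<and>
     rank_regret D S = Min {rank_regret D S' |S'. S' \<noteq> {} \<and> S' \<subseteq> D \<and> card S' \<le> r}"

definition dual_line :: "tuple \<Rightarrow> real \<Rightarrow> real" where
  "dual_line t x = t $ 1 * x + t $ 2 * (1 - x)"

definition general_position :: "tuple set \<Rightarrow> bool" where
  "general_position D \<longleftrightarrow>
     (\<forall>i. inj_on (\<lambda>t. t $ i) D) \<and>
     \<not> (\<exists>a\<in>D. \<exists>b\<in>D. \<exists>c\<in>D. \<exists>x\<in>{0..1}. a \<noteq> b \<and> a \<noteq> c \<and> b \<noteq> c \<and>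
          dual_line a x = dual_line b x \<and> dual_line b x = dual_line c x)"

definition intersect_in :: "tuple \<Rightarrow> tuple \<Rightarrow> real set \<Rightarrow> bool" where
  "intersect_in a b I \<longleftrightarrow> (\<exists>x\<in>I. dual_line a x = dual_line b x)"

text \<open>Only used for distinct tuples whose lines do intersect; the abscissa is then unique.\<close>

definition crossing :: "tuple \<Rightarrow> tuple \<Rightarrow> real" where
  "crossing a b = (THE x. dual_line a x = dual_line b x)"

text \<open>In the algorithm a line is represented by its tuple, and the rows of the matrix are indexed by
  the skyline tuples themselves rather than by their numbers \<open>1, \<dots>, s\<close>.
  A cell is a sequence of lines together with its (possibly infinite) rank.
  The queue contains pairs (upper line, lower line), ordered as at the time of insertion.\<close>

type_synonym cells = "tuple \<times> nat \<Rightarrow> tuple list \<times> enat"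

record rrm_state =
  order :: "tuple list"
  queue :: "(tuple \<times> tuple) set"
  cells :: cells

definition position :: "tuple list \<Rightarrow> tuple \<Rightarrow> nat" where
  "position L t = Suc (length (takeWhile (\<lambda>t'. t' \<noteq> t) L))"

definition just_above :: "tuple list \<Rightarrow> tuple \<Rightarrow> tuple \<Rightarrow> bool" where
  "just_above L a b \<longleftrightarrow> (\<exists>k. Suc k < length L \<and> L ! k = a \<and> L ! Suc k = b)"

definition initial_order :: "tuple set \<Rightarrow> tuple list" where
  "initial_order D = (THE L. set L = D \<and> sorted_wrt (\<lambda>a b. a $ 2 > b $ 2) L)"

text \<open>Only the cells \<open>(t, h)\<close> with \<open>t \<in> skyline D\<close> and \<open>h \<le> r\<close> are ever read; column \<open>0\<close> encodes
  the convention that its rank is infinite.\<close>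

definition initial_cells :: "tuple list \<Rightarrow> cells" where
  "initial_cells L = (\<lambda>(t, h). if h = 0 then ([], \<infinity>) else ([t], enat (position L t)))"

definition initial_state :: "tuple set \<Rightarrow> rrm_state" where
  "initial_state D = (let L = initial_order D in
     \<lparr>order = L,
      queue = {(a, b). just_above L a b \<and> intersect_in a b {0<..<1}},
      cells = initial_cells L\<rparr>)"

definition update_column :: "tuple set \<Rightarrow> tuple \<Rightarrow> tuple \<Rightarrow> nat \<Rightarrow> nat \<Rightarrow> cells \<Rightarrow> cells" where
  "update_column D a b k h M =
     (let M' = M((a, h) := (fst (M (a, h)), max (snd (M (a, h))) (enat k)))
      in if b \<in> skyline D \<and> snd (M' (b, h)) > snd (M' (a, h - 1))
         then M'((b, h) := (fst (M' (a, h - 1)) @ [b], snd (M' (a, h - 1))))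
         else M')"

text \<open>The columns are updated in the order \<open>r, r - 1, \<dots>, 1\<close>, so column \<open>h - 1\<close> still has its old
  value when column \<open>h\<close> is updated.\<close>

definition update_cells :: "tuple set \<Rightarrow> nat \<Rightarrow> tuple \<Rightarrow> tuple \<Rightarrow> nat \<Rightarrow> cells \<Rightarrow> cells" where
  "update_cells D r a b k M =
     (if a \<in> skyline D then fold (update_column D a b k) (rev [1..<Suc r]) M else M)"

text \<open>One iteration of the loop for the removed intersection \<open>(a, b)\<close>, with \<open>a\<close> the upper line.
  On a list without repetitions, mapping \<open>transpose a b\<close> swaps \<open>a\<close> and \<open>b\<close>.\<close>

definition process :: "tuple set \<Rightarrow> nat \<Rightarrow> tuple \<Rightarrow> tuple \<Rightarrow> rrm_state \<Rightarrow> rrm_state" where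
  "process D r a b st =
     (let c = crossing a b;
          L = map (Transposition.transpose a b) (order st)
      in \<lparr>order = L,
          queue = (queue st - {(a, b)})
            \<union> {(q, b) |q. just_above L q b \<and> intersect_in q b {c<..<1}}
            \<union> {(a, p) |p. just_above L a p \<and> intersect_in a p {c<..<1}},
          cells = update_cells D r a b (position L a) (cells st)\<rparr>)"

text \<open>Several intersections may share the smallest abscissa; the relation allows any of them to be
  removed. A step does not demand that \<open>a\<close> be immediately above \<open>b\<close>, so no run is discarded
  by such a guard: an iteration is possible whenever the queue has an entry of minimal key.\<close>

definition rrm_step :: "tuple set \<Rightarrow> nat \<Rightarrow> rrm_state \<Rightarrow> rrm_state \<Rightarrow> bool" where
  "rrm_step D r st st' \<longleftrightarrow>
     (\<exists>a b. (a, b) \<in> queue st \<and>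
            (\<forall>(a', b')\<in>queue st. crossing a b \<le> crossing a' b') \<and>
            st' = process D r a b st)"

definition rrm_terminates :: "tuple set \<Rightarrow> nat \<Rightarrow> bool" where
  "rrm_terminates D r \<longleftrightarrow>
     \<not> (\<exists>run. run 0 = initial_state D \<and> (\<forall>k. rrm_step D r (run k) (run (Suc k))))"

definition rrm_returns :: "tuple set \<Rightarrow> nat \<Rightarrow> tuple set \<Rightarrow> bool" where
  "rrm_returns D r S \<longleftrightarrow>
     (\<exists>st. (rrm_step D r)\<^sup>*\<^sup>* (initial_state D) st \<and> queue st = {} \<and>
       (\<exists>t\<in>skyline D. (\<forall>t'\<in>skyline D. snd (cells st (t, r)) \<le> snd (cells st (t', r))) \<and>
                       S = set (fst (cells st (t, r)))))"

end

theory Submission imports Defs begin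

text \<open>The list order at abscissa \<open>c\<close> weakly sorts the lines by their height over \<open>c\<close>, and the queue
  always contains the adjacent pairs that still have to be swapped. As no three lines are
  concurrent, a queue entry of least abscissa is such an adjacent pair, so every step removes exactly
  one inversion with respect to the final order.

  A cell \<open>(q, v)\<close> of a line \<open>t\<close> is sound: over every abscissa in \<open>[0, c]\<close> some line of \<open>q\<close> has
  rank at most \<open>v\<close>. It is also good enough: if \<open>t\<close> is the top line of a set \<open>S\<close> of skyline lines
  and column \<open>h\<close> admits all lines of \<open>S\<close> that were on top so far, then \<open>v\<close> is at most the rank
  regret of \<open>S\<close>. An arbitrary set can be replaced by skyline tuples dominating its members.\<close>

section \<open>Positions in a list without repetitions\<close>

lemma position_nth:
  assumes "distinct L" "i < length L"
  shows "position L (L ! i) = Suc i"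
  using assms
proof (induction L arbitrary: i)
  case (Cons y L)
  then show ?case by (cases i) (auto simp: position_def)
qed simp

lemma bij_betw_position:
  assumes "distinct L"
  shows "bij_betw (position L) (set L) {1..length L}"
proof (intro bij_betwI')
  fix s t assume "s \<in> set L" "t \<in> set L"
  then show "position L s = position L t \<longleftrightarrow> s = t"
    by (metis assms position_nth in_set_conv_nth old.nat.inject)
next
  fix s assume "s \<in> set L"
  then obtain i where "i < length L" "L ! i = s" by (auto simp: in_set_conv_nth)
  then show "position L s \<in> {1..length L}" using position_nth[OF assms, of i] by auto
next
  fix k assume k: "k \<in> {1..length L}"
  then have "position L (L ! (k - 1)) = k" by (subst position_nth[OF assms]) auto
  then show "\<exists>s\<in>set L. k = position L s" using k by (intro bexI[of _ "L ! (k - 1)"]) auto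
qed

lemma just_above_iff_position:
  assumes "distinct L"
  shows "just_above L s t \<longleftrightarrow> s \<in> set L \<and> t \<in> set L \<and> position L t = Suc (position L s)"
proof
  assume "just_above L s t"
  then obtain k where k: "Suc k < length L" "L ! k = s" "L ! Suc k = t"
    by (auto simp: just_above_def)
  have "position L s = Suc k" "position L t = Suc (Suc k)"
    using position_nth[OF assms, of k] position_nth[OF assms, of "Suc k"] k by auto
  then show "s \<in> set L \<and> t \<in> set L \<and> position L t = Suc (position L s)" using k by auto
next
  assume *: "s \<in> set L \<and> t \<in> set L \<and> position L t = Suc (position L s)"
  then obtain i j where ij: "i < length L" "L ! i = s" "j < length L" "L ! j = t"
    by (auto simp: in_set_conv_nth)
  then have "j = Suc i" using * position_nth[OF assms, of i] position_nth[OF assms, of j] by auto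
  then show "just_above L s t" using ij by (auto simp: just_above_def)
qed

lemma position_map_transpose:
  "position (map (Transposition.transpose a b) L) t = position L (Transposition.transpose a b t)"
proof -
  have *: "(\<lambda>t'. t' \<noteq> t) \<circ> Transposition.transpose a b = (\<lambda>t'. t' \<noteq> Transposition.transpose a b t)"
    by (auto simp: fun_eq_iff)
  show ?thesis unfolding position_def takeWhile_map * by simp
qed

text \<open>Brings positions into the shape of \<open>line_rank\<close>, one plus the size of a set,
  so that the two can be compared by inclusion of sets of lines.\<close>

lemma position_eq_card:
  assumes "distinct L" "t \<in> set L"
  shows "position L t = Suc (card {s \<in> set L. position L s < position L t})"
proof -
  note bij = bij_betw_position[OF assms(1)]
  have t: "position L t \<in> {1..length L}" using bij assms(2) by (auto dest: bij_betwE)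
  have "bij_betw (position L) {s \<in> set L. position L s < position L t} {1..<position L t}"
    unfolding bij_betw_def
  proof
    show "inj_on (position L) {s \<in> set L. position L s < position L t}"
      using bij by (auto simp: bij_betw_def intro: inj_on_subset)
    show "position L ` {s \<in> set L. position L s < position L t} = {1..<position L t}"
    proof (intro equalityI subsetI)
      fix k assume k: "k \<in> {1..<position L t}"
      then have "k \<in> {1..length L}" using t by auto
      then have "k \<in> position L ` set L" using bij by (simp add: bij_betw_def)
      then obtain s where "s \<in> set L" "position L s = k" by blast
      then show "k \<in> position L ` {s \<in> set L. position L s < position L t}" using k by auto
    next
      fix k assume "k \<in> position L ` {s \<in> set L. position L s < position L t}"
      then show "k \<in> {1..<position L t}" using bij by (auto dest: bij_betwE)
    qed
  qed
  from bij_betw_same_card[OF this] show ?thesis using t by auto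
qed

section \<open>Dual lines and their crossings\<close>

lemma dual_line_0 [simp]: "dual_line t 0 = t $ 2"
  and dual_line_1 [simp]: "dual_line t 1 = t $ 1"
  by (simp_all add: dual_line_def)

text \<open>The difference of two dual lines is affine in \<open>x\<close>; the two lemmas that
  follow read its sign off the interpolation weights \<open>d - x\<close> and
  \<open>x - c\<close>.\<close>

lemma dual_line_diff_convex:
  assumes "c < d"
  shows "dual_line a x - dual_line b x =
    ((d - x) * (dual_line a c - dual_line b c) + (x - c) * (dual_line a d - dual_line b d)) / (d - c)"
proof -
  have "(dual_line a x - dual_line b x) * (d - c) =
    (d - x) * (dual_line a c - dual_line b c) + (x - c) * (dual_line a d - dual_line b d)"
    by (simp add: dual_line_def algebra_simps)
  then show ?thesis using assms by (simp add: eq_divide_eq)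
qed

lemma dual_line_le_between:
  assumes "dual_line b c \<le> dual_line a c" "dual_line b d \<le> dual_line a d" "c \<le> x" "x \<le> d"
  shows "dual_line b x \<le> dual_line a x"
proof (cases "c < d")
  case True
  have "0 \<le> dual_line a x - dual_line b x"
    using assms True by (subst dual_line_diff_convex[OF True], intro divide_nonneg_nonneg add_nonneg_nonneg mult_nonneg_nonneg) auto
  then show ?thesis by simp
next
  case False
  then have "x = c" using assms by simp
  then show ?thesis using assms by simp
qed

text \<open>A tie at \<open>c\<close> is harmless because the weight \<open>x - c\<close> of the
  strict endpoint is positive. This allows \<open>c\<close> to be an abscissa where the lines
  meet.\<close>

lemma dual_line_less_between:
  assumes "dual_line b c \<le> dual_line a c" "dual_line b d < dual_line a d" "c < x" "x \<le> d"
  shows "dual_line b x < dual_line a x"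
proof -
  have cd: "c < d" using assms by simp
  have "0 < dual_line a x - dual_line b x"
    using assms cd by (subst dual_line_diff_convex[OF cd], intro divide_pos_pos add_nonneg_pos mult_nonneg_nonneg mult_pos_pos) auto
  then show ?thesis by simp
qed

text \<open>A difference that falls from nonnegative to negative has negative slope
  \<open>m\<close>, hence exactly one zero \<open>z\<close>, which is then what
  \<open>crossing\<close> denotes. The last claim concerns every real \<open>x\<close>, not only
  those between \<open>c\<close> and \<open>d\<close>.\<close>

lemma crossing_of_swapped:
  assumes "dual_line b c \<le> dual_line a c" "dual_line a d < dual_line b d" "c \<le> d"
  shows "dual_line a (crossing a b) = dual_line b (crossing a b)"
    and "c \<le> crossing a b" "crossing a b < d"
    and "dual_line b x \<le> dual_line a x \<longleftrightarrow> x \<le> crossing a b"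
proof -
  define m where "m = (a $ 1 - b $ 1) - (a $ 2 - b $ 2)"
  define z where "z = - (a $ 2 - b $ 2) / m"
  have diff: "dual_line a x - dual_line b x = (a $ 2 - b $ 2) + m * x" for x
    by (simp add: dual_line_def m_def algebra_simps)
  have "m * d < m * c" using diff[of c] diff[of d] assms by linarith
  then have m: "m < 0" using assms(3) by (simp add: mult_less_cancel_left)
  have diff': "dual_line a x - dual_line b x = m * (x - z)" for x
    unfolding diff using m by (simp add: z_def field_simps)
  have z: "dual_line a x = dual_line b x \<longleftrightarrow> x = z" for x
    using diff'[of x] m by auto
  have [simp]: "crossing a b = z" unfolding crossing_def z by simp
  show "dual_line a (crossing a b) = dual_line b (crossing a b)" using z by simp
  show le: "dual_line b x \<le> dual_line a x \<longleftrightarrow> x \<le> crossing a b" for x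
  proof -
    have "dual_line b x \<le> dual_line a x \<longleftrightarrow> 0 \<le> dual_line a x - dual_line b x" by simp
    also have "\<dots> \<longleftrightarrow> x \<le> z" unfolding diff' using m by (auto simp: zero_le_mult_iff)
    finally show ?thesis by simp
  qed
  show "c \<le> crossing a b" using le[of c] assms by simp
  show "crossing a b < d" using le[of d] assms by simp
qed

section \<open>Ranks at an abscissa and rank regret\<close>

definition line_rank :: "tuple set \<Rightarrow> real \<Rightarrow> tuple \<Rightarrow> nat" where
  "line_rank D x t = Suc (card {t'\<in>D. dual_line t x < dual_line t' x})"

text \<open>Positive scaling of \<open>u\<close> preserves ranks, and scaling to coordinate sum 1
  turns utilities into heights of dual lines. Only the zero vector is left out.\<close>

lemma tuple_rank_eq_line_rank:
  assumes "u \<in> utilities" "u $ 1 + u $ 2 > 0"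
  shows "tuple_rank D u t = line_rank D (u $ 1 / (u $ 1 + u $ 2)) t"
proof -
  define m where "m = u $ 1 + u $ 2"
  have m: "m > 0" using assms by (simp add: m_def)
  have *: "1 - u $ 1 / m = u $ 2 / m" using m by (simp add: field_simps) (simp add: m_def)
  have "utility u t = m * dual_line t (u $ 1 / m)" for t
    unfolding utility_def dual_line_def * using m by (simp add: distrib_left)
  then show ?thesis using m by (simp add: tuple_rank_def line_rank_def m_def[symmetric])
qed

lemma tuple_rank_zero:
  assumes "u \<in> utilities" "\<not> u $ 1 + u $ 2 > 0"
  shows "tuple_rank D u t = 1"
proof -
  have "u $ 1 \<ge> 0" "u $ 2 \<ge> 0" using assms by (auto simp: utilities_def)
  then have "u $ 1 = 0" "u $ 2 = 0" using assms(2) by linarith+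
  then show ?thesis by (simp add: tuple_rank_def utility_def)
qed

text \<open>\<open>MAX\<close> over the infinite set \<open>utilities\<close> is meaningful only for
  a finite image; a crude bound on the ranks provides that.\<close>

lemma finite_set_rank_image:
  assumes "finite D" "S \<subseteq> D" "S \<noteq> {}"
  shows "finite ((\<lambda>u. set_rank D u S) ` U)"
proof -
  have fin: "finite S" using assms finite_subset by auto
  have "set_rank D u S \<le> Suc (card D)" for u
  proof -
    obtain s where "s \<in> S" using assms by auto
    then have "set_rank D u S \<le> tuple_rank D u s" unfolding set_rank_def using fin by simp
    also have "\<dots> \<le> Suc (card D)" unfolding tuple_rank_def using assms(1) by (auto intro: card_mono)
    finally show ?thesis .
  qed
  then have "(\<lambda>u. set_rank D u S) ` U \<subseteq> {..Suc (card D)}" by auto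
  then show ?thesis by (rule finite_subset) simp
qed

text \<open>The abscissas in the unit interval account for all nonzero utility vectors. The
  assumption \<open>v >= 1\<close> covers the zero vector, for which all tuples tie.\<close>

lemma rank_regret_le:
  assumes "finite D" "S \<subseteq> D" "S \<noteq> {}" "v \<ge> 1"
    and "\<And>x. x \<in> {0..1} \<Longrightarrow> \<exists>s\<in>S. line_rank D x s \<le> v"
  shows "rank_regret D S \<le> v"
  unfolding rank_regret_def
proof (rule Max.boundedI)
  show "finite ((\<lambda>u. set_rank D u S) ` utilities)" using assms finite_set_rank_image by blast
  show "(\<lambda>u. set_rank D u S) ` utilities \<noteq> {}" by (auto simp: utilities_def intro: exI[of _ 0])
  fix k assume "k \<in> (\<lambda>u. set_rank D u S) ` utilities"
  then obtain u where u: "u \<in> utilities" "k = set_rank D u S" by auto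
  have fin: "finite S" using assms finite_subset by auto
  have "\<exists>s\<in>S. tuple_rank D u s \<le> v"
  proof (cases "u $ 1 + u $ 2 > 0")
    case True
    have "u $ 1 \<ge> 0" "u $ 2 \<ge> 0" using u by (auto simp: utilities_def)
    then have "u $ 1 / (u $ 1 + u $ 2) \<in> {0..1}" using True by (auto simp: field_simps)
    from assms(5)[OF this] show ?thesis using tuple_rank_eq_line_rank[OF u(1) True] by simp
  next
    case False
    then show ?thesis using tuple_rank_zero[OF u(1) False] assms by auto
  qed
  then obtain s where s: "s \<in> S" "tuple_rank D u s \<le> v" by auto
  have "set_rank D u S \<le> tuple_rank D u s" unfolding set_rank_def using fin s by simp
  then show "k \<le> v" using s u by simp
qed

lemma le_rank_regret:
  assumes "finite D" "S \<subseteq> D" "S \<noteq> {}" "x \<in> {0..1}"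
    and "\<And>s. s \<in> S \<Longrightarrow> v \<le> line_rank D x s"
  shows "v \<le> rank_regret D S"
proof -
  \<comment> \<open>The coordinate sum is 1, so \<open>u\<close> corresponds to the abscissa
    \<open>x\<close> itself.\<close>
  define u :: "real ^ 2" where "u = vector [x, 1 - x]"
  have u12: "u $ 1 = x" "u $ 2 = 1 - x" by (simp_all add: u_def)
  then have u: "u \<in> utilities" using assms(4) by (auto simp: utilities_def forall_2)
  have fin: "finite S" using assms finite_subset by auto
  have "tuple_rank D u s = line_rank D x s" for s using tuple_rank_eq_line_rank[OF u] u12 by simp
  then have "v \<le> set_rank D u S" unfolding set_rank_def using fin assms by simp
  also have "\<dots> \<le> rank_regret D S" unfolding rank_regret_def
    using u assms finite_set_rank_image by (intro Max_ge) auto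
  finally show ?thesis .
qed

section \<open>Domination and skyline tuples\<close>

lemma skyline_subset: "skyline D \<subseteq> D" by (auto simp: skyline_def)

text \<open>The two unit vectors already test both attributes.\<close>

lemma utility_le_all_iff:
  "(\<forall>u\<in>utilities. utility u s \<le> utility u t) \<longleftrightarrow> (s $ 1 \<le> t $ 1 \<and> s $ 2 \<le> t $ 2)"
proof
  assume *: "\<forall>u\<in>utilities. utility u s \<le> utility u t"
  have "axis 1 1 \<in> utilities" "axis 2 1 \<in> utilities"
    by (auto simp: utilities_def axis_def)
  from this[THEN *[rule_format]]
  have "utility (axis 1 1) s \<le> utility (axis 1 1) t" "utility (axis 2 1) s \<le> utility (axis 2 1) t" .
  then show "s $ 1 \<le> t $ 1 \<and> s $ 2 \<le> t $ 2" by (simp add: utility_def axis_def)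
next
  assume *: "s $ 1 \<le> t $ 1 \<and> s $ 2 \<le> t $ 2"
  show "\<forall>u\<in>utilities. utility u s \<le> utility u t"
  proof
    fix u :: "real ^ 2" assume "u \<in> utilities"
    then have "0 \<le> u $ 1" "0 \<le> u $ 2" by (simp_all add: utilities_def)
    with * show "utility u s \<le> utility u t"
      unfolding utility_def by (intro add_mono mult_left_mono) simp_all
  qed
qed

text \<open>Among the tuples dominating \<open>s\<close>, one with maximal attribute sum is taken. A
  tuple dominating it also dominates \<open>s\<close>, so its sum is no larger; then both attributes
  agree and no utility separates the two.\<close>

lemma skyline_dominates:
  assumes "finite D" "s \<in> D"
  obtains t where "t \<in> skyline D" "\<And>u. u \<in> utilities \<Longrightarrow> utility u s \<le> utility u t"
proof -
  let ?A = "{t \<in> D. s $ 1 \<le> t $ 1 \<and> s $ 2 \<le> t $ 2}"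
  let ?f = "\<lambda>t::tuple. t $ 1 + t $ 2"
  have "finite ?A" "s \<in> ?A" using assms by auto
  then have "finite (?f ` ?A)" "?f ` ?A \<noteq> {}" by blast+
  then have "Max (?f ` ?A) \<in> ?f ` ?A" "\<And>t'. t' \<in> ?A \<Longrightarrow> ?f t' \<le> Max (?f ` ?A)"
    by (rule Max_in, intro Max_ge) auto
  then obtain t where t: "t \<in> ?A" "\<And>t'. t' \<in> ?A \<Longrightarrow> ?f t' \<le> ?f t"
    by (metis (no_types, lifting) imageE)
  have "t \<in> skyline D"
  proof (rule ccontr)
    assume "t \<notin> skyline D"
    then obtain t' v where t': "t' \<in> D" "\<forall>u\<in>utilities. utility u t \<le> utility u t'"
      "v \<in> utilities" "utility v t < utility v t'" using t(1) by (auto simp: skyline_def)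
    then have le: "t $ 1 \<le> t' $ 1" "t $ 2 \<le> t' $ 2" by (auto simp: utility_le_all_iff)
    then have "?f t' \<le> ?f t" using t t'(1) by force
    with le have "t' $ 1 \<le> t $ 1" "t' $ 2 \<le> t $ 2" by auto
    with utility_le_all_iff[of t' t] t' show False by force
  qed
  then show thesis using that utility_le_all_iff[of s t] t(1) by auto
qed

lemma skyline_nonempty:
  assumes "finite D" "D \<noteq> {}"
  shows "skyline D \<noteq> {}"
proof -
  obtain s where "s \<in> D" using assms by auto
  with assms(1) obtain t where "t \<in> skyline D" using skyline_dominates[of D s] by metis
  then show ?thesis by auto
qed

text \<open>Replacing a tuple by a skyline tuple dominating it can only shrink the set of tuples
  that beat it, for every \<open>u\<close>, and an image is no larger than the original set.\<close>

lemma skyline_reduction: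
  assumes "finite D" "S \<subseteq> D" "S \<noteq> {}"
  obtains S' where "S' \<subseteq> skyline D" "S' \<noteq> {}" "card S' \<le> card S" "rank_regret D S' \<le> rank_regret D S"
proof -
  have fin: "finite S" using assms finite_subset by auto
  have "\<forall>s\<in>S. \<exists>t\<in>skyline D. \<forall>u\<in>utilities. utility u s \<le> utility u t"
  proof
    fix s assume "s \<in> S"
    then have "s \<in> D" using assms(2) by auto
    show "\<exists>t\<in>skyline D. \<forall>u\<in>utilities. utility u s \<le> utility u t"
      by (rule skyline_dominates[OF assms(1) \<open>s \<in> D\<close>]) blast
  qed
  then obtain f where f: "\<And>s. s \<in> S \<Longrightarrow> f s \<in> skyline D"
      "\<And>s u. s \<in> S \<Longrightarrow> u \<in> utilities \<Longrightarrow> utility u s \<le> utility u (f s)" by metis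
  have sub: "f ` S \<subseteq> D" using f skyline_subset by blast
  have "set_rank D u (f ` S) \<le> set_rank D u S" if u: "u \<in> utilities" for u
  proof -
    have "set_rank D u S \<in> tuple_rank D u ` S" unfolding set_rank_def using assms fin by (intro Min_in) auto
    then obtain s where s: "s \<in> S" "set_rank D u S = tuple_rank D u s" by auto
    have "set_rank D u (f ` S) \<le> tuple_rank D u (f s)" unfolding set_rank_def using fin s by simp
    also have "\<dots> \<le> tuple_rank D u s" unfolding tuple_rank_def
      using f(2)[OF s(1) u] assms(1) by (auto intro!: card_mono)
    finally show ?thesis using s by simp
  qed
  moreover have "finite ((\<lambda>u. set_rank D u S) ` utilities)" using assms finite_set_rank_image by blast
  moreover have "(0::real ^ 2) \<in> utilities" by (simp add: utilities_def)
  moreover have "finite ((\<lambda>u. set_rank D u (f ` S)) ` utilities)"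
    using assms sub by (intro finite_set_rank_image) auto
  ultimately have "rank_regret D (f ` S) \<le> rank_regret D S" unfolding rank_regret_def
    by (subst Max_le_iff) (auto intro: Max_ge order_trans)
  then show thesis using that[of "f ` S"] f assms fin card_image_le[of S f] by auto
qed

section \<open>Closed forms for the cell update and the initial order\<close>

lemma update_cells_apply:
  assumes "a \<noteq> b"
  shows "update_cells D r a b k M (t, h) =
    (if a \<notin> skyline D \<or> h \<notin> {1..r} then M (t, h)
     else if t = a then (fst (M (a, h)), max (snd (M (a, h))) (enat k))
     else if t = b \<and> b \<in> skyline D \<and> snd (M (a, h - 1)) < snd (M (b, h))
     then (fst (M (a, h - 1)) @ [b], snd (M (a, h - 1)))
     else M (t, h))"
proof -
  have col: "update_column D a b k j M (t, h) =
    (if h \<noteq> j then M (t, h)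
     else if t = a then (fst (M (a, h)), max (snd (M (a, h))) (enat k))
     else if t = b \<and> b \<in> skyline D \<and> snd (M (a, h - 1)) < snd (M (b, h))
     then (fst (M (a, h - 1)) @ [b], snd (M (a, h - 1)))
     else M (t, h))" if "j > 0" for j M t h
    using assms that by (auto simp: update_column_def Let_def)
  have "fold (update_column D a b k) (rev [1..<Suc r]) M (t, h) =
    (if h \<notin> {1..r} then M (t, h)
     else if t = a then (fst (M (a, h)), max (snd (M (a, h))) (enat k))
     else if t = b \<and> b \<in> skyline D \<and> snd (M (a, h - 1)) < snd (M (b, h))
     then (fst (M (a, h - 1)) @ [b], snd (M (a, h - 1)))
     else M (t, h))"
  proof (induction r arbitrary: M)
    case (Suc r)
    have *: "rev [1..<Suc (Suc r)] = Suc r # rev [1..<Suc r]" by simp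
    have **: "0 < Suc r" by simp
    show ?case
    proof (cases "h = Suc r")
      case True
      then show ?thesis unfolding * fold.simps comp_apply Suc.IH col[OF **] by simp
    next
      case False
      \<comment> \<open>The first update writes to column \<open>Suc r\<close> only, so the
        induction hypothesis still sees the old entries.\<close>
      then have "update_column D a b k (Suc r) M (s, h) = M (s, h)"
        "h \<in> {1..r} \<Longrightarrow> update_column D a b k (Suc r) M (s, h - 1) = M (s, h - 1)" for s
        unfolding col[OF **] by auto
      moreover have "h \<in> {1..Suc r} \<longleftrightarrow> h \<in> {1..r}" using False by auto
      ultimately show ?thesis unfolding * fold.simps comp_apply Suc.IH by simp
    qed
  qed simp
  then show ?thesis
    by (cases "a \<in> skyline D") (simp_all only: update_cells_def if_True if_False simp_thms)
qed

text \<open>The \<open>THE\<close> requires existence and uniqueness; a strictly sorted list is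
  determined by its set. Negating the second attribute turns the descending order into the ascending
  one of \<open>sorted_list_of_set\<close>.\<close>

lemma initial_order:
  assumes "finite D" "inj_on (\<lambda>t::tuple. t $ 2) D"
  shows "set (initial_order D) = D \<and> sorted_wrt (\<lambda>a b. a $ 2 > b $ 2) (initial_order D)"
proof -
  let ?f = "\<lambda>t::tuple. - (t $ 2)"
  have inj: "inj_on ?f D" using assms(2) by (auto simp: inj_on_def)
  define L where "L = map (the_inv_into D ?f) (sorted_list_of_set (?f ` D))"
  have set_L: "set L = D" unfolding L_def
    using assms(1) inj by simp
  have "map ?f L = map (\<lambda>x. x) (sorted_list_of_set (?f ` D))"
    unfolding L_def map_map using assms(1)
    by (intro map_cong refl) (auto simp: f_the_inv_into_f[OF inj])
  then have "map ?f L = sorted_list_of_set (?f ` D)" by simp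
  then have "sorted_wrt (<) (map ?f L)" by simp
  then have "sorted_wrt (\<lambda>a b. a $ 2 > b $ 2) L" by (simp add: sorted_wrt_map)
  moreover have "L' = L" if "set L' = D" "sorted_wrt (\<lambda>a b. a $ 2 > b $ 2) L'" for L'
  proof -
    have "map ?f L' = map ?f L"
    proof (rule strict_sorted_equal)
      show "sorted_wrt (<) (map ?f L')" using that(2) by (simp add: sorted_wrt_map)
      show "sorted_wrt (<) (map ?f L)" by fact
      show "set (map ?f L') = set (map ?f L)" using set_L that by simp
    qed
    then show ?thesis using map_inj_on[of ?f L' L] inj set_L that(1) by simp
  qed
  ultimately have "\<exists>!L. set L = D \<and> sorted_wrt (\<lambda>a b. a $ 2 > b $ 2) L" using set_L by blast
  then show ?thesis unfolding initial_order_def by (rule theI')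
qed

section \<open>The state of the sweep\<close>

locale rrm_input =
  fixes D :: "tuple set" and r :: nat
  assumes data: "dataset D" and gen_pos: "general_position D" and r_pos: "r \<ge> 1"
begin

lemma finite_D: "finite D" and D_nonempty: "D \<noteq> {}"
  using data by (auto simp: dataset_def)

lemma coordinate_inj: "s \<in> D \<Longrightarrow> t \<in> D \<Longrightarrow> s $ i = t $ i \<Longrightarrow> s = t"
  using gen_pos by (auto simp: general_position_def inj_on_def)

lemma no_triple_point:
  "\<lbrakk>s \<in> D; t \<in> D; p \<in> D; 0 \<le> x; x \<le> 1; s \<noteq> t; s \<noteq> p; t \<noteq> p;
    dual_line s x = dual_line t x; dual_line t x = dual_line p x\<rbrakk> \<Longrightarrow> False"
  using gen_pos unfolding general_position_def by (meson atLeastAtMost_iff)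

abbreviation pos :: "rrm_state \<Rightarrow> tuple \<Rightarrow> nat" where
  "pos st \<equiv> position (order st)"

text \<open>The inequality is weak so that at a crossing the list counts as sorted both before and
  after the swap.\<close>

definition sorted_at :: "rrm_state \<Rightarrow> real \<Rightarrow> bool" where
  "sorted_at st x \<longleftrightarrow> (\<forall>s\<in>D. \<forall>t\<in>D. pos st s < pos st t \<longrightarrow> dual_line t x \<le> dual_line s x)"

text \<open>These are the inversions with respect to the order at abscissa 1, where the height of
  \<open>t\<close> is \<open>t $ 1\<close>.\<close>

definition pending :: "rrm_state \<Rightarrow> (tuple \<times> tuple) set" where
  "pending st = {(s, t). s \<in> D \<and> t \<in> D \<and> pos st s < pos st t \<and> s $ 1 < t $ 1}"

text \<open>The queue may contain pairs that another swap has separated. Hence it is only required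
  to lie between the adjacent pending pairs and all pending pairs.\<close>

definition sweep_invariant :: "rrm_state \<Rightarrow> real \<Rightarrow> bool" where
  "sweep_invariant st c \<longleftrightarrow> distinct (order st) \<and> set (order st) = D \<and> 0 \<le> c \<and> c < 1 \<and>
     sorted_at st c \<and> queue st \<subseteq> pending st \<and>
     (\<forall>s t. (s, t) \<in> pending st \<and> pos st t = Suc (pos st s) \<longrightarrow> (s, t) \<in> queue st)"

lemma pos_eq_iff:
  assumes "sweep_invariant st c" "s \<in> D" "t \<in> D"
  shows "pos st s = pos st t \<longleftrightarrow> s = t"
  using assms bij_betw_position[of "order st"]
  by (auto simp: sweep_invariant_def bij_betw_def inj_on_def)

lemma pos_above_exists:
  assumes "sweep_invariant st c" "t \<in> D" "0 < k" "k \<le> pos st t"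
  obtains s where "s \<in> D" "pos st s = k"
proof -
  have *: "pos st ` D = {1..length (order st)}"
    using assms(1) bij_betw_position[of "order st"] by (simp add: sweep_invariant_def bij_betw_def)
  then have "pos st t \<le> length (order st)" using assms(2) by (metis atLeastAtMost_iff imageI)
  then have "k \<in> pos st ` D" using * assms by simp
  then show thesis using that by auto
qed

lemma pos_eq_card:
  assumes "sweep_invariant st c" "t \<in> D"
  shows "pos st t = Suc (card {s \<in> D. pos st s < pos st t})"
  using assms position_eq_card[of "order st" t] by (simp add: sweep_invariant_def)

text \<open>Chains the comparisons of consecutive lines from \<open>s\<close> down to
  \<open>t\<close>.\<close>

lemma sorted_at_adjacent:
  assumes inv: "sweep_invariant st c"
    and adj: "\<And>s t. \<lbrakk>s \<in> D; t \<in> D; pos st t = Suc (pos st s)\<rbrakk> \<Longrightarrow> dual_line t x \<le> dual_line s x"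
  shows "sorted_at st x"
  unfolding sorted_at_def
proof (intro ballI impI)
  fix s t assume "s \<in> D" "t \<in> D" "pos st s < pos st t"
  then show "dual_line t x \<le> dual_line s x"
  proof (induction "pos st t" arbitrary: t)
    case (Suc k)
    show ?case
    proof (cases "pos st s = k")
      case True
      then show ?thesis using adj Suc by metis
    next
      case False
      then have k: "0 < k" "pos st s < k" using Suc by auto
      then obtain p where p: "p \<in> D" "pos st p = k"
        using pos_above_exists[OF inv \<open>t \<in> D\<close>, of k] Suc by auto
      then have "dual_line p x \<le> dual_line s x" using Suc k by metis
      moreover have "dual_line t x \<le> dual_line p x" using adj p Suc by metis
      ultimately show ?thesis by simp
    qed
  qed simp
qed

lemma sorted_at_between:
  assumes "sorted_at st c" "sorted_at st d" "c \<le> x" "x \<le> d"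
  shows "sorted_at st x"
  using assms unfolding sorted_at_def by (meson dual_line_le_between)

text \<open>Every line strictly higher at \<open>x\<close> precedes \<open>t\<close> in the list.
  Equality may fail because lines tied with \<open>t\<close> at \<open>x\<close> may precede it as
  well.\<close>

lemma line_rank_le_pos:
  assumes "sweep_invariant st c" "sorted_at st x" "t \<in> D"
  shows "line_rank D x t \<le> pos st t"
proof -
  have "{t' \<in> D. dual_line t x < dual_line t' x} \<subseteq> {s \<in> D. pos st s < pos st t}"
  proof safe
    fix s assume s: "s \<in> D" "dual_line t x < dual_line s x"
    then have "\<not> pos st t < pos st s" using assms(2,3) unfolding sorted_at_def by (meson leD)
    moreover have "pos st t \<noteq> pos st s" using pos_eq_iff[OF assms(1)] s assms(3) by force
    ultimately show "pos st s < pos st t" by simp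
  qed
  then have "card {t' \<in> D. dual_line t x < dual_line t' x} \<le> card {s \<in> D. pos st s < pos st t}"
    using finite_D by (intro card_mono) auto
  then show ?thesis using pos_eq_card[OF assms(1,3)] by (simp add: line_rank_def)
qed

text \<open>A pending pair is in weak order at \<open>c\<close> and strictly inverted at 1, as
  \<open>crossing_of_swapped\<close> requires.\<close>

lemma crossing_pending:
  assumes "sweep_invariant st c" "(s, t) \<in> pending st"
  shows "dual_line s (crossing s t) = dual_line t (crossing s t)"
    and "c \<le> crossing s t" "crossing s t < 1"
    and "dual_line t x \<le> dual_line s x \<longleftrightarrow> x \<le> crossing s t"
proof -
  have "dual_line t c \<le> dual_line s c" "dual_line s 1 < dual_line t 1" "c \<le> 1"
    using assms by (simp_all add: sweep_invariant_def sorted_at_def pending_def)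
  note * = crossing_of_swapped[OF this]
  show "dual_line s (crossing s t) = dual_line t (crossing s t)"
    "c \<le> crossing s t" "crossing s t < 1"
    "dual_line t x \<le> dual_line s x \<longleftrightarrow> x \<le> crossing s t"
    by (fact *)+
qed

text \<open>No adjacent pair gets inverted before the minimal crossing: a pending one is in the
  queue and crosses no earlier, and any other is in order at both \<open>c\<close> and 1. A line
  listed between \<open>a\<close> and \<open>b\<close> would pass through their common point,
  against general position.\<close>

lemma minimal_crossing:
  assumes inv: "sweep_invariant st c" and ab: "(a, b) \<in> queue st"
    and min: "\<forall>(a', b')\<in>queue st. crossing a b \<le> crossing a' b'"
  shows "sorted_at st (crossing a b)" and "pos st b = Suc (pos st a)"
proof -
  let ?x = "crossing a b"
  have pend: "(a, b) \<in> pending st" using inv ab by (auto simp: sweep_invariant_def)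
  note x = crossing_pending[OF inv pend]
  have srt: "sorted_at st c" using inv by (simp add: sweep_invariant_def)
  show sorted: "sorted_at st ?x"
  proof (rule sorted_at_adjacent[OF inv])
    fix s t assume st: "s \<in> D" "t \<in> D" "pos st t = Suc (pos st s)"
    show "dual_line t ?x \<le> dual_line s ?x"
    proof (cases "s $ 1 < t $ 1")
      case True
      then have "(s, t) \<in> pending st" using st by (simp add: pending_def)
      moreover then have "(s, t) \<in> queue st" using inv st by (simp add: sweep_invariant_def)
      ultimately show ?thesis using crossing_pending(4)[OF inv] min by blast
    next
      case False
      have "dual_line t c \<le> dual_line s c" using srt st by (simp add: sorted_at_def)
      then show ?thesis using False x dual_line_le_between[of t c s 1 ?x] by simp
    qed
  qed
  have ab': "a \<in> D" "b \<in> D" "pos st a < pos st b" using pend by (auto simp: pending_def)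
  show "pos st b = Suc (pos st a)"
  proof (rule ccontr)
    assume "pos st b \<noteq> Suc (pos st a)"
    then have "Suc (pos st a) < pos st b" using ab' by simp
    then obtain p where p: "p \<in> D" "pos st p = Suc (pos st a)"
      using pos_above_exists[OF inv ab'(2), of "Suc (pos st a)"] by auto
    have "dual_line p ?x \<le> dual_line a ?x" "dual_line b ?x \<le> dual_line p ?x"
      using sorted p ab' \<open>Suc (pos st a) < pos st b\<close> by (auto simp: sorted_at_def)
    then have "dual_line p ?x = dual_line a ?x" "dual_line b ?x = dual_line p ?x" using x(1) by auto
    moreover have "p \<noteq> a" "p \<noteq> b" "a \<noteq> b"
      using p ab' \<open>Suc (pos st a) < pos st b\<close> by auto
    moreover have "0 \<le> ?x" "?x \<le> 1" using x inv by (auto simp: sweep_invariant_def)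
    ultimately show False using no_triple_point[of b p a ?x] p ab' by metis
  qed
qed

lemma pos_process:
  "pos (process D r a b st) t = pos st (Transposition.transpose a b t)"
  by (simp add: process_def Let_def position_map_transpose)

text \<open>Exchanging neighbours changes no relative order except their own.\<close>

lemma pos_process_less_iff:
  assumes "sweep_invariant st c" "a \<in> D" "b \<in> D" "pos st b = Suc (pos st a)" "s \<in> D" "t \<in> D"
  shows "pos (process D r a b st) s < pos (process D r a b st) t \<longleftrightarrow>
    (s, t) \<noteq> (a, b) \<and> ((s, t) = (b, a) \<or> pos st s < pos st t)"
proof -
  have "pos st s = pos st a \<longleftrightarrow> s = a" "pos st t = pos st a \<longleftrightarrow> t = a"
    "pos st s = pos st b \<longleftrightarrow> s = b" "pos st t = pos st b \<longleftrightarrow> t = b"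
    "pos st a = pos st b \<longleftrightarrow> a = b"
    using pos_eq_iff[OF assms(1)] assms by blast+
  then show ?thesis
    using assms(4) unfolding pos_process Transposition.transpose_def by (auto split: if_splits)
qed

section \<open>What the matrix cells guarantee\<close>

definition cells_sound :: "rrm_state \<Rightarrow> real \<Rightarrow> bool" where
  "cells_sound st c \<longleftrightarrow> (\<forall>t\<in>skyline D. snd (cells st (t, 0)) = \<infinity> \<and>
     (\<forall>h\<in>{1..r}. t \<in> set (fst (cells st (t, h))) \<and> set (fst (cells st (t, h))) \<subseteq> D \<and>
        length (fst (cells st (t, h))) \<le> h \<and> enat (pos st t) \<le> snd (cells st (t, h)) \<and>
        (\<forall>x\<in>{0..c}. \<exists>s\<in>set (fst (cells st (t, h))). enat (line_rank D x s) \<le> snd (cells st (t, h)))))"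

text \<open>As the sweep proceeds, the top line of \<open>S\<close> only changes to one with a larger \<open>t $ 1\<close>. The lines of \<open>S\<close>
  with \<open>t $ 1\<close> no larger than that of the current top one thus include all former top lines.\<close>

definition cells_complete :: "rrm_state \<Rightarrow> bool" where
  "cells_complete st \<longleftrightarrow> (\<forall>S t h. S \<subseteq> skyline D \<longrightarrow> t \<in> S \<longrightarrow> (\<forall>s\<in>S. pos st t \<le> pos st s) \<longrightarrow>
     h \<le> r \<longrightarrow> card {s\<in>S. s $ 1 \<le> t $ 1} \<le> h \<longrightarrow> snd (cells st (t, h)) \<le> enat (rank_regret D S))"

text \<open>Between \<open>c\<close> and \<open>d\<close> the line \<open>t\<close> itself is the
  witness: its rank is at most its position, which the value of the cell bounds. This is the purpose
  of the clause on \<open>pos st t\<close>.\<close>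

lemma cells_sound_advance:
  assumes inv: "sweep_invariant st c" and sound: "cells_sound st c" and srt: "sorted_at st d"
  shows "cells_sound st d"
  unfolding cells_sound_def
proof (intro ballI conjI)
  fix t assume t: "t \<in> skyline D"
  then have tD: "t \<in> D" using skyline_subset by auto
  show "snd (cells st (t, 0)) = \<infinity>" using sound t by (simp add: cells_sound_def)
  fix h assume h: "h \<in> {1..r}"
  from sound t h have *: "t \<in> set (fst (cells st (t, h)))" "set (fst (cells st (t, h))) \<subseteq> D"
    "length (fst (cells st (t, h))) \<le> h" "enat (pos st t) \<le> snd (cells st (t, h))"
    and past: "\<And>x. x \<in> {0..c} \<Longrightarrow> \<exists>s\<in>set (fst (cells st (t, h))). enat (line_rank D x s) \<le> snd (cells st (t, h))"
    unfolding cells_sound_def by blast+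
  show "t \<in> set (fst (cells st (t, h)))" "set (fst (cells st (t, h))) \<subseteq> D"
    "length (fst (cells st (t, h))) \<le> h" "enat (pos st t) \<le> snd (cells st (t, h))" by (fact *)+
  fix x assume x: "x \<in> {0..d}"
  show "\<exists>s\<in>set (fst (cells st (t, h))). enat (line_rank D x s) \<le> snd (cells st (t, h))"
  proof (cases "x \<le> c")
    case True
    then show ?thesis using past x by simp
  next
    case False
    have "sorted_at st c" using inv by (simp add: sweep_invariant_def)
    from sorted_at_between[OF this srt] have "sorted_at st x" using False x by simp
    from line_rank_le_pos[OF inv this tD] have "enat (line_rank D x t) \<le> snd (cells st (t, h))"
      using *(4) by (metis enat_ord_simps(1) order_trans)
    then show ?thesis using *(1) by blast
  qed
qed

section \<open>One iteration of the loop\<close>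

context
  fixes st :: rrm_state and c :: real and a b :: tuple and st' :: rrm_state
  assumes inv: "sweep_invariant st c" and ab: "(a, b) \<in> queue st"
    and min: "\<forall>(a', b')\<in>queue st. crossing a b \<le> crossing a' b'"
    and st': "st' = process D r a b st"
begin

lemma pending_ab: "(a, b) \<in> pending st"
  using inv ab by (auto simp: sweep_invariant_def)

lemma a_in: "a \<in> D" and b_in: "b \<in> D" and a_less_b: "a $ 1 < b $ 1" and a_neq_b: "a \<noteq> b"
  using pending_ab by (auto simp: pending_def)

lemmas sorted_at_crossing = minimal_crossing(1)[OF inv ab min]
lemmas adjacent_ab = minimal_crossing(2)[OF inv ab min]
lemmas crossing_ab = crossing_pending[OF inv pending_ab]

lemma crossing_bounds: "0 \<le> crossing a b" "crossing a b \<le> 1"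
  using crossing_ab inv by (auto simp: sweep_invariant_def)

lemma pos_st'_less_iff:
  "s \<in> D \<Longrightarrow> t \<in> D \<Longrightarrow> pos st' s < pos st' t \<longleftrightarrow>
    (s, t) \<noteq> (a, b) \<and> ((s, t) = (b, a) \<or> pos st s < pos st t)"
  unfolding st' by (rule pos_process_less_iff[OF inv a_in b_in adjacent_ab])

lemma pos_st': "pos st' a = pos st b" "pos st' b = pos st a" "t \<noteq> a \<Longrightarrow> t \<noteq> b \<Longrightarrow> pos st' t = pos st t"
  unfolding st' pos_process by simp_all

text \<open>The swap affects the pair of \<open>a\<close> and \<open>b\<close> alone, and
  \<open>(b, a)\<close> is not pending because \<open>a $ 1 < b $ 1\<close>.\<close>

lemma pending_st': "pending st' = pending st - {(a, b)}"
  using a_less_b pos_st'_less_iff by (auto simp: pending_def)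

text \<open>At the crossing \<open>a\<close> and \<open>b\<close> have equal height, so their
  exchange does not disturb the order there.\<close>

lemma sorted_at_st': "sorted_at st' (crossing a b)"
  unfolding sorted_at_def
proof (intro ballI impI)
  fix s t assume st: "s \<in> D" "t \<in> D" "pos st' s < pos st' t"
  then have "(s, t) = (b, a) \<or> pos st s < pos st t" using pos_st'_less_iff by blast
  then show "dual_line t (crossing a b) \<le> dual_line s (crossing a b)"
    using crossing_ab(1) sorted_at_crossing st(1,2) by (auto simp: sorted_at_def)
qed

lemma third_line_off_crossing:
  assumes "s \<in> D" "s \<noteq> a" "s \<noteq> b"
  shows "dual_line s (crossing a b) \<noteq> dual_line a (crossing a b)"
  using no_triple_point[OF assms(1) a_in b_in crossing_bounds assms(2,3) a_neq_b] crossing_ab(1)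
  by blast

lemma order_st': "distinct (order st')" "set (order st') = D"
proof -
  have o: "order st' = map (Transposition.transpose a b) (order st)"
    by (simp add: st' process_def Let_def)
  have d: "distinct (order st)" "set (order st) = D" using inv by (auto simp: sweep_invariant_def)
  show "distinct (order st')" unfolding o using d by (simp add: distinct_map)
  show "set (order st') = D" unfolding o using d a_in b_in by simp
qed

lemma just_above_st': "just_above (order st') s t \<longleftrightarrow> s \<in> D \<and> t \<in> D \<and> pos st' t = Suc (pos st' s)"
  using just_above_iff_position[OF order_st'(1)] order_st'(2) by simp

lemma queue_st': "queue st' = (queue st - {(a, b)})
    \<union> {(q, b) |q. just_above (order st') q b \<and> intersect_in q b {crossing a b<..<1}}
    \<union> {(a, p) |p. just_above (order st') a p \<and> intersect_in a p {crossing a b<..<1}}"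
  by (simp add: st' process_def Let_def)

text \<open>If \<open>s\<close> were the higher line at 1, it would be strictly higher everywhere to
  the right of the current crossing up to 1. A meeting there therefore forces an inversion at
  1.\<close>

lemma new_intersection_pending:
  assumes "just_above (order st') s t" "intersect_in s t {crossing a b<..<1}"
  shows "(s, t) \<in> pending st'"
proof -
  have st: "s \<in> D" "t \<in> D" "pos st' s < pos st' t" using assms(1) by (auto simp: just_above_st')
  obtain y where y: "crossing a b < y" "y < 1" "dual_line s y = dual_line t y"
    using assms(2) by (auto simp: intersect_in_def)
  have "dual_line t (crossing a b) \<le> dual_line s (crossing a b)"
    using sorted_at_st' st by (simp add: sorted_at_def)
  then have "\<not> t $ 1 < s $ 1" using dual_line_less_between[of t "crossing a b" s 1 y] y by auto
  moreover have "s $ 1 \<noteq> t $ 1" using coordinate_inj[of s t 1] st by auto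
  ultimately show ?thesis using st by (simp add: pending_def)
qed

text \<open>One line of the pair is \<open>a\<close> or \<open>b\<close> and the other is a third
  line, which by general position misses the point where \<open>a\<close> and \<open>b\<close> meet.
  So the crossing of the pair itself lies strictly to the right.\<close>

lemma pending_intersects:
  assumes "(s, t) \<in> pending st'" "s = a \<or> t = b"
  shows "intersect_in s t {crossing a b<..<1}"
proof -
  have p: "(s, t) \<in> pending st" "(s, t) \<noteq> (a, b)" using assms(1) by (auto simp: pending_st')
  then have st: "s \<in> D" "t \<in> D" "s \<noteq> t" "pos st s < pos st t" by (auto simp: pending_def)
  note x = crossing_pending[OF inv p(1)]
  have "s \<noteq> b" "t \<noteq> a" using assms(2) st adjacent_ab by auto
  then have "dual_line s (crossing a b) \<noteq> dual_line t (crossing a b)"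
    using third_line_off_crossing[of s] third_line_off_crossing[of t] st p(2) assms(2) crossing_ab(1)
    by auto
  moreover have "crossing a b \<le> crossing s t"
    using sorted_at_crossing st x(4)[of "crossing a b"] unfolding sorted_at_def by blast
  ultimately have "crossing a b < crossing s t" using x(1) by (cases "crossing a b = crossing s t") auto
  then show ?thesis using x by (auto simp: intersect_in_def)
qed

lemma sweep_invariant_process: "sweep_invariant st' (crossing a b)"
proof -
  have "queue st' \<subseteq> pending st'"
    unfolding queue_st' using new_intersection_pending inv
    by (auto simp: pending_st' sweep_invariant_def)
  moreover have "(s, t) \<in> queue st'" if p: "(s, t) \<in> pending st'" and adj: "pos st' t = Suc (pos st' s)" for s t
  proof (cases "s = a \<or> t = b")
    case True
    have "just_above (order st') s t" using p adj by (auto simp: just_above_st' pending_def)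
    then show ?thesis using True pending_intersects[OF p True] unfolding queue_st' by blast
  next
    case False
    have p': "(s, t) \<in> pending st" "(s, t) \<noteq> (a, b)" using p by (auto simp: pending_st')
    then have D: "s \<in> D" "t \<in> D" "s $ 1 < t $ 1" by (auto simp: pending_def)
    have inj: "pos st s = pos st t \<longleftrightarrow> s = t" if "s \<in> D" "t \<in> D" for s t
      using pos_eq_iff[OF inv that] .
    \<comment> \<open>After the swap the line just below \<open>b\<close> is \<open>a\<close>, and
      \<open>(b, a)\<close> is not pending; the same holds for the line just above \<open>a\<close>.
      Hence the pair avoids both swapped lines and was adjacent before.\<close>
    have "s \<noteq> b"
    proof
      assume "s = b"
      then have "pos st' t = pos st b" "t \<noteq> b" using adj pos_st' adjacent_ab D by auto
      then have "t = a" using pos_st'(3)[of t] inj[OF D(2) b_in] by auto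
      then show False using D \<open>s = b\<close> a_less_b by simp
    qed
    moreover have "t \<noteq> a"
    proof
      assume "t = a"
      then have "pos st' s = pos st a" "s \<noteq> a" using adj pos_st' adjacent_ab D by auto
      then have "s = b" using pos_st'(3)[of s] inj[OF D(1) a_in] by auto
      then show False using D \<open>t = a\<close> a_less_b by simp
    qed
    ultimately have "pos st t = Suc (pos st s)" using adj False pos_st'(3) by metis
    then have "(s, t) \<in> queue st" using inv p' by (simp add: sweep_invariant_def)
    then show ?thesis unfolding queue_st' using p' by blast
  qed
  ultimately show ?thesis
    using order_st' crossing_bounds crossing_ab(3) sorted_at_st' unfolding sweep_invariant_def by auto
qed

lemma card_pending_process: "card (pending st') < card (pending st)"
proof -
  have "finite (pending st)"
    by (rule finite_subset[of _ "D \<times> D"]) (auto simp: pending_def finite_D)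
  then show ?thesis unfolding pending_st' using pending_ab by (rule card_Diff1_less)
qed

text \<open>Just to the right of the crossing the list order is the true order around \<open>a\<close>, so
  there the new position of \<open>a\<close> is a rank that \<open>S\<close> cannot avoid.\<close>

lemma pos_le_rank_regret:
  assumes S: "S \<subseteq> D" "a \<in> S" "b \<notin> S" and top: "\<And>s. s \<in> S \<Longrightarrow> pos st' a \<le> pos st' s"
  shows "pos st' a \<le> rank_regret D S"
proof -
  let ?x = "crossing a b" and ?F = "at_right (crossing a b)"
  \<comment> \<open>Strict inequalities at the crossing persist by continuity.\<close>
  have near: "eventually (\<lambda>y. dual_line s y < dual_line t y) ?F" if "dual_line s ?x < dual_line t ?x" for s t
  proof -
    have "((\<lambda>y. dual_line t y - dual_line s y) \<longlongrightarrow> dual_line t ?x - dual_line s ?x) ?F"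
      unfolding dual_line_def by (intro tendsto_intros)
    then have "eventually (\<lambda>y. 0 < dual_line t y - dual_line s y) ?F"
      by (rule order_tendstoD) (use that in simp)
    then show ?thesis by simp
  qed
  have interval: "eventually (\<lambda>y. y \<in> {?x<..<1}) ?F" by (rule eventually_at_right_real[OF crossing_ab(3)])
  have above: "eventually (\<lambda>y. dual_line a y < dual_line d y) ?F"
    if d: "d \<in> D" "pos st' d < pos st' a" for d
  \<comment> \<open>The line \<open>b\<close> ties with \<open>a\<close> at the crossing but is
    higher at 1, hence higher immediately afterwards. Every other line listed above \<open>a\<close>
    is strictly higher already at the crossing.\<close>
  proof (cases "d = b")
    case True
    have "dual_line a y < dual_line b y" if "y \<in> {?x<..<1}" for y
      using dual_line_less_between[of a ?x b 1 y] crossing_ab(1) a_less_b that by simp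
    then show ?thesis unfolding True using interval by (rule eventually_mono[rotated])
  next
    case False
    have "dual_line a ?x \<le> dual_line d ?x" using sorted_at_st' d a_in by (simp add: sorted_at_def)
    moreover have "d \<noteq> a" using d by auto
    ultimately have "dual_line a ?x < dual_line d ?x"
      using third_line_off_crossing[OF d(1) _ False] by force
    then show ?thesis by (rule near)
  qed
  have below: "eventually (\<lambda>y. dual_line s y \<le> dual_line a y) ?F" if s: "s \<in> S" for s
  proof (cases "s = a")
    case False
    have sD: "s \<in> D" "s \<noteq> b" using s S by auto
    have "pos st' a < pos st' s"
      using top[OF s] pos_eq_iff[OF sweep_invariant_process a_in sD(1)] False by force
    then have "dual_line s ?x \<le> dual_line a ?x" using sorted_at_st' sD a_in by (simp add: sorted_at_def)
    then have "dual_line s ?x < dual_line a ?x"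
      using third_line_off_crossing[OF sD(1) False sD(2)] by force
    from near[OF this] show ?thesis by (rule eventually_mono) simp
  qed simp
  \<comment> \<open>There are finitely many conditions, each valid close to the crossing, so one
    \<open>y\<close> satisfies them all.\<close>
  have "eventually (\<lambda>y. (\<forall>d\<in>{d \<in> D. pos st' d < pos st' a}. dual_line a y < dual_line d y)
      \<and> (\<forall>s\<in>S. dual_line s y \<le> dual_line a y) \<and> y \<in> {?x<..<1}) ?F"
    using above below interval finite_D finite_subset[OF S(1) finite_D]
    by (intro eventually_conj eventually_ball_finite) auto
  then obtain y where y: "\<And>d. d \<in> D \<Longrightarrow> pos st' d < pos st' a \<Longrightarrow> dual_line a y < dual_line d y"
      "\<And>s. s \<in> S \<Longrightarrow> dual_line s y \<le> dual_line a y" "?x < y" "y < 1"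
    using eventually_happens'[OF trivial_limit_at_right_real] by (smt (verit) mem_Collect_eq greaterThanLessThan_iff)
  show ?thesis
  proof (rule le_rank_regret[OF finite_D S(1)])
    show "S \<noteq> {}" using S by auto
    show "y \<in> {0..1}" using y crossing_bounds by auto
    fix s assume s: "s \<in> S"
    \<comment> \<open>At \<open>y\<close> no line of \<open>S\<close> is above \<open>a\<close>, so
      every line listed above \<open>a\<close> beats \<open>s\<close>.\<close>
    have "{d \<in> D. pos st' d < pos st' a} \<subseteq> {d \<in> D. dual_line s y < dual_line d y}"
      using y(1) y(2)[OF s] by fastforce
    then have "card {d \<in> D. pos st' d < pos st' a} \<le> card {d \<in> D. dual_line s y < dual_line d y}"
      using finite_D by (intro card_mono) auto
    then show "pos st' a \<le> line_rank D y s"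
      using pos_eq_card[OF sweep_invariant_process a_in] by (simp add: line_rank_def)
  qed
qed

lemma cells_st':
  "cells st' (t, h) =
    (if a \<notin> skyline D \<or> h \<notin> {1..r} then cells st (t, h)
     else if t = a then (fst (cells st (a, h)), max (snd (cells st (a, h))) (enat (pos st' a)))
     else if t = b \<and> b \<in> skyline D \<and> snd (cells st (a, h - 1)) < snd (cells st (b, h))
     then (fst (cells st (a, h - 1)) @ [b], snd (cells st (a, h - 1)))
     else cells st (t, h))"
proof -
  have "cells st' = update_cells D r a b (pos st' a) (cells st)"
    by (simp add: st' process_def Let_def)
  then show ?thesis using update_cells_apply[OF a_neq_b] by simp
qed

text \<open>The old cells are first carried to the crossing with the old positions. Then
  \<open>a\<close>, which moves down, has its value raised to its new position; \<open>b\<close> may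
  take over a cell of \<open>a\<close>, whose value covers the position that \<open>b\<close>
  inherits; an unchanged cell belongs to a line that has not moved down.\<close>

lemma cells_sound_process:
  assumes "cells_sound st c"
  shows "cells_sound st' (crossing a b)"
proof -
  let ?x = "crossing a b"
  have old: "cells_sound st ?x"
    using cells_sound_advance[OF inv assms] sorted_at_crossing by simp
  note aD = a_in and bD = b_in and adj = adjacent_ab a_neq_b and pos' = pos_st'
  show ?thesis unfolding cells_sound_def
  proof (rule ballI, rule conjI, goal_cases)
    case (1 t)
    then show ?case using old by (simp add: cells_st' cells_sound_def)
  next
    case (2 t)
    show ?case
    proof
      fix h assume h: "h \<in> {1..r}"
      have cell: "t \<in> set (fst (cells st (t, h)))" "set (fst (cells st (t, h))) \<subseteq> D"
        "length (fst (cells st (t, h))) \<le> h" "enat (pos st t) \<le> snd (cells st (t, h))"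
        "\<And>x. x \<in> {0..?x} \<Longrightarrow> \<exists>s\<in>set (fst (cells st (t, h))). enat (line_rank D x s) \<le> snd (cells st (t, h))"
        if "t \<in> skyline D" "h \<in> {1..r}" for t h
        using old that unfolding cells_sound_def by blast+
      have unchanged: "cells st' (t, h) = cells st (t, h)"
        if "t \<noteq> a" "\<not> (t = b \<and> a \<in> skyline D \<and> b \<in> skyline D \<and> snd (cells st (a, h - 1)) < snd (cells st (b, h)))"
        unfolding cells_st' using that by presburger
      consider (lower) "t = a" "a \<in> skyline D"
        | (switch) "t = b" "a \<in> skyline D" "b \<in> skyline D" "snd (cells st (a, h - 1)) < snd (cells st (b, h))"
        | (keep) "t \<noteq> a" "cells st' (t, h) = cells st (t, h)"
        using 2 unchanged by blast
      then show "t \<in> set (fst (cells st' (t, h))) \<and> set (fst (cells st' (t, h))) \<subseteq> D \<and>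
        length (fst (cells st' (t, h))) \<le> h \<and> enat (pos st' t) \<le> snd (cells st' (t, h)) \<and>
        (\<forall>x\<in>{0..?x}. \<exists>s\<in>set (fst (cells st' (t, h))). enat (line_rank D x s) \<le> snd (cells st' (t, h)))"
      proof cases
        case lower
        then have eq: "cells st' (t, h) = (fst (cells st (t, h)), max (snd (cells st (t, h))) (enat (pos st' t)))"
          using h by (simp add: cells_st')
        show ?thesis unfolding eq fst_conv snd_conv le_max_iff_disj
          using cell[OF 2 h] order_refl by blast
      next
        case switch
        then have eq: "cells st' (t, h) = (fst (cells st (a, h - 1)) @ [t], snd (cells st (a, h - 1)))"
          using h adj by (simp add: cells_st')
        \<comment> \<open>Column 0 has infinite value, so it never wins the strict
          comparison.\<close>
        have "h - 1 \<noteq> 0"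
        proof
          assume "h - 1 = 0"
          then have "snd (cells st (a, h - 1)) = \<infinity>" using old switch by (simp add: cells_sound_def)
          then show False using switch by simp
        qed
        then have h': "h - 1 \<in> {1..r}" using h by auto
        note cell' = cell[OF switch(2) h']
        show ?thesis unfolding eq fst_conv snd_conv
        proof (intro conjI ballI)
          show "t \<in> set (fst (cells st (a, h - 1)) @ [t])" by simp
          show "set (fst (cells st (a, h - 1)) @ [t]) \<subseteq> D" using cell'(2) switch(1) bD by simp
          show "length (fst (cells st (a, h - 1)) @ [t]) \<le> h" using cell'(3) h by auto
          show "enat (pos st' t) \<le> snd (cells st (a, h - 1))" using cell'(4) switch(1) pos' by simp
          fix x assume "x \<in> {0..?x}"
          from cell'(5)[OF this] show "\<exists>s\<in>set (fst (cells st (a, h - 1)) @ [t]).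
            enat (line_rank D x s) \<le> snd (cells st (a, h - 1))" by auto
        qed
      next
        case keep
        have "pos st' t \<le> pos st t" using keep(1) pos' adj by (cases "t = b") auto
        then have "enat (pos st' t) \<le> snd (cells st (t, h))"
          using cell(4)[OF 2 h] by (metis enat_ord_simps(1) order_trans)
        then show ?thesis unfolding keep(2) using cell[OF 2 h] by blast
      qed
    qed
  qed
qed

text \<open>Either the top of \<open>S\<close> passes from \<open>a\<close> to \<open>b\<close>,
  which is matched by the takeover from column \<open>h - 1\<close>, or the top is unchanged. In the
  latter case a value can grow only for \<open>a\<close>, and then at most to its new position,
  which \<open>pos_le_rank_regret\<close> bounds.\<close>

lemma cells_complete_process:
  assumes complete: "cells_complete st"
  shows "cells_complete st'"
  unfolding cells_complete_def
proof (intro allI impI)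
  fix S t h
  assume S: "S \<subseteq> skyline D" and t: "t \<in> S" and top': "\<forall>s\<in>S. pos st' t \<le> pos st' s"
    and h: "h \<le> r" and crd: "card {s\<in>S. s $ 1 \<le> t $ 1} \<le> h"
  have SD: "S \<subseteq> D" using S skyline_subset by blast
  then have fin: "finite S" using finite_D finite_subset by auto
  note aD = a_in and bD = b_in and adj = adjacent_ab a_neq_b a_less_b
  have less': "pos st' p < pos st' q \<longleftrightarrow> (p, q) \<noteq> (a, b) \<and> ((p, q) = (b, a) \<or> pos st p < pos st q)"
    if "p \<in> D" "q \<in> D" for p q using pos_st'_less_iff that by simp
  have "{s\<in>S. s $ 1 \<le> t $ 1} \<noteq> {}" "finite {s\<in>S. s $ 1 \<le> t $ 1}" using t fin by auto
  \<comment> \<open>The line \<open>t\<close> counts itself, so \<open>h\<close> is not 0.\<close>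
  then have h_pos: "h \<in> {1..r}" using crd h card_gt_0_iff[of "{s\<in>S. s $ 1 \<le> t $ 1}"] by simp
  note IH = complete[unfolded cells_complete_def, rule_format, OF S]
  have top_less: "pos st' t < pos st' s" if "s \<in> S" "s \<noteq> t" for s
    using top' that t SD pos_eq_iff[OF sweep_invariant_process, of t s] by force
  show "snd (cells st' (t, h)) \<le> enat (rank_regret D S)"
  proof (cases "t = b \<and> a \<in> S")
    case True
    have "pos st a \<le> pos st s" if "s \<in> S" for s
    proof (cases "s = b")
      case False
      then have "pos st' b < pos st' s" using top_less that True by blast
      then show ?thesis using less'[of b s] adj that SD bD by (cases "s = a") auto
    qed (simp add: adj)
    \<comment> \<open>The line \<open>b\<close> is counted on the right but not on the left, so the
      former top \<open>a\<close> fits into column \<open>h - 1\<close>.\<close>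
    moreover have "card {s\<in>S. s $ 1 \<le> a $ 1} < card {s\<in>S. s $ 1 \<le> b $ 1}"
      using fin True t adj(3) by (intro psubset_card_mono) force+
    ultimately have "snd (cells st (a, h - 1)) \<le> enat (rank_regret D S)"
      using IH[of a "h - 1"] True h crd by auto
    moreover have "snd (cells st' (b, h)) \<le> snd (cells st (a, h - 1))"
      using True t S h_pos adj by (auto simp: cells_st')
    ultimately show ?thesis using True by auto
  next
    case False
    have "pos st t \<le> pos st s" if "s \<in> S" for s
    proof (cases "s = t")
      case False
      then have "pos st' t < pos st' s" "s \<in> D" "t \<in> D" using top_less that t SD by auto
      then show ?thesis using less'[of t s] \<open>\<not> (t = b \<and> a \<in> S)\<close> that by auto
    qed simp
    then have old: "snd (cells st (t, h)) \<le> enat (rank_regret D S)" using IH t h crd by blast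
    show ?thesis
    proof (cases "t = a")
      case True
      \<comment> \<open>After the swap \<open>b\<close> is above \<open>a\<close>, so
        \<open>a\<close> could not be the top line of a set containing \<open>b\<close>.\<close>
      have "b \<notin> S" using top_less[of b] less'[of b a] aD bD adj True by auto
      then have "pos st' a \<le> rank_regret D S"
        using pos_le_rank_regret SD t top' True by simp
      then show ?thesis using old True by (auto simp: cells_st')
    next
      case False
      then have "snd (cells st' (t, h)) \<le> snd (cells st (t, h))" by (auto simp: cells_st')
      then show ?thesis using old by simp
    qed
  qed
qed

end

section \<open>Runs of the algorithm and termination\<close>

definition invariant :: "rrm_state \<Rightarrow> bool" where
  "invariant st \<longleftrightarrow> (\<exists>c. sweep_invariant st c \<and> cells_sound st c) \<and> cells_complete st"

lemma invariant_step:
  assumes "invariant st" "rrm_step D r st st'"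
  shows "invariant st'" "card (pending st') < card (pending st)"
proof -
  obtain c where c: "sweep_invariant st c" "cells_sound st c" "cells_complete st"
    using assms(1) by (auto simp: invariant_def)
  obtain a b where ab: "(a, b) \<in> queue st" "st' = process D r a b st"
      "\<forall>(a', b')\<in>queue st. crossing a b \<le> crossing a' b'"
    using assms(2) unfolding rrm_step_def by blast
  note step = c(1) ab(1,3,2)
  show "invariant st'" unfolding invariant_def
    using sweep_invariant_process[OF step] cells_sound_process[OF step]
      cells_complete_process[OF step] c by blast
  show "card (pending st') < card (pending st)" using card_pending_process[OF step] by simp
qed

lemma invariant_initial: "invariant (initial_state D)"
proof -
  let ?L = "initial_order D" and ?st = "initial_state D"
  have L: "set ?L = D" "sorted_wrt (\<lambda>a b. a $ 2 > b $ 2) ?L"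
    using initial_order[of D] finite_D coordinate_inj by (auto simp: inj_on_def)
  have dist: "distinct ?L"
    using L(2) by (auto simp: distinct_conv_nth sorted_wrt_iff_nth_less nat_neq_iff) force+
  have st: "order ?st = ?L" "queue ?st = {(a, b). just_above ?L a b \<and> intersect_in a b {0<..<1}}"
    "cells ?st = initial_cells ?L" by (simp_all add: initial_state_def Let_def)
  have imp: "t $ 2 < s $ 2" if D: "s \<in> D" "t \<in> D" and lt: "position ?L s < position ?L t" for s t
  proof -
    obtain i j where ij: "i < length ?L" "?L ! i = s" "j < length ?L" "?L ! j = t"
      using D by (metis L(1) in_set_conv_nth)
    then have "i < j" using lt position_nth[OF dist, of i] position_nth[OF dist, of j] by simp
    then show ?thesis using sorted_wrt_nth_less[OF L(2), of i j] ij by simp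
  qed
  have pos_inj: "position ?L s = position ?L t \<Longrightarrow> s = t" if "s \<in> D" "t \<in> D" for s t
    using bij_betw_position[OF dist] that L(1) by (auto simp: bij_betw_def inj_on_def)
  have pos_iff: "position ?L s < position ?L t \<longleftrightarrow> t $ 2 < s $ 2" if "s \<in> D" "t \<in> D" for s t
    using imp[of s t] imp[of t s] pos_inj[of s t] that
    by (cases "position ?L s" "position ?L t" rule: linorder_cases) auto
  have adj: "just_above ?L s t \<longleftrightarrow> s \<in> D \<and> t \<in> D \<and> position ?L t = Suc (position ?L s)" for s t
    using just_above_iff_position[OF dist] L(1) by simp
  \<comment> \<open>At abscissa 0 the two lines are strictly ordered, so they meet inside the
    interval exactly if they are inverted at 1.\<close>
  have inter: "intersect_in s t {0<..<1} \<longleftrightarrow> s $ 1 < t $ 1" if st: "s \<in> D" "t \<in> D" "t $ 2 < s $ 2" for s t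
  proof
    assume "intersect_in s t {0<..<1}"
    then obtain y where y: "0 < y" "y < 1" "dual_line s y = dual_line t y" by (auto simp: intersect_in_def)
    have "\<not> t $ 1 < s $ 1" using dual_line_less_between[of t 0 s 1 y] y st by auto
    moreover have "s $ 1 \<noteq> t $ 1" using coordinate_inj[of s t 1] st by auto
    ultimately show "s $ 1 < t $ 1" by simp
  next
    assume *: "s $ 1 < t $ 1"
    then have x: "dual_line s (crossing s t) = dual_line t (crossing s t)" "0 \<le> crossing s t" "crossing s t < 1"
      using crossing_of_swapped(1-3)[of t 0 s 1] st by simp_all
    have "crossing s t \<noteq> 0" using x(1) st(3) by auto
    then show "intersect_in s t {0<..<1}" using x by (auto simp: intersect_in_def)
  qed
  have sweep: "sweep_invariant ?st 0"
    unfolding sweep_invariant_def sorted_at_def pending_def st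
    using dist L(1) by (auto simp: pos_iff inter adj intro: less_imp_le)
       (metis inter lessI pos_iff)+
  have srt: "sorted_at ?st 0" using sweep by (simp add: sweep_invariant_def)
  \<comment> \<open>Here equality holds, since there are no ties at abscissa 0.\<close>
  have rank0: "line_rank D 0 t = position ?L t" if "t \<in> D" for t
  proof -
    have "{t' \<in> D. dual_line t 0 < dual_line t' 0} = {s \<in> D. position ?L s < position ?L t}"
      using pos_iff that by auto
    then show ?thesis using pos_eq_card[OF sweep that] by (simp add: line_rank_def st)
  qed
  have "cells_sound ?st 0"
    unfolding cells_sound_def st using skyline_subset[of D] by (auto simp: initial_cells_def rank0)
  moreover have "cells_complete ?st" unfolding cells_complete_def st
  proof (intro allI impI)
    fix S t h
    assume S: "S \<subseteq> skyline D" and t: "t \<in> S" and top: "\<forall>s\<in>S. position ?L t \<le> position ?L s"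
      and crd: "card {s\<in>S. s $ 1 \<le> t $ 1} \<le> h"
    have SD: "S \<subseteq> D" using S skyline_subset by blast
    then have fin: "finite S" using finite_D finite_subset by auto
    have "{s\<in>S. s $ 1 \<le> t $ 1} \<noteq> {}" "finite {s\<in>S. s $ 1 \<le> t $ 1}" using t fin by auto
    then have "h \<noteq> 0" using crd card_gt_0_iff[of "{s\<in>S. s $ 1 \<le> t $ 1}"] by simp
    \<comment> \<open>At abscissa 0 the line \<open>t\<close> is the highest of \<open>S\<close>, so
      no member of \<open>S\<close> has a better rank there.\<close>
    moreover have "position ?L t \<le> rank_regret D S"
      by (rule le_rank_regret[OF finite_D SD, of 0]) (use t top SD rank0 in auto)
    ultimately show "snd (initial_cells ?L (t, h)) \<le> enat (rank_regret D S)"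
      by (simp add: initial_cells_def)
  qed
  ultimately show ?thesis using sweep by (auto simp: invariant_def)
qed

lemma invariant_reachable:
  assumes "(rrm_step D r)\<^sup>*\<^sup>* (initial_state D) st"
  shows "invariant st"
  using assms by induction (auto intro: invariant_initial invariant_step)

text \<open>The number of pending pairs drops with every iteration, which bounds the length of a
  run.\<close>

lemma terminates: "rrm_terminates D r"
  unfolding rrm_terminates_def
proof
  assume "\<exists>run. run 0 = initial_state D \<and> (\<forall>k. rrm_step D r (run k) (run (Suc k)))"
  then obtain run where run: "run 0 = initial_state D" "\<And>k. rrm_step D r (run k) (run (Suc k))" by blast
  have inv: "invariant (run k)" for k
    by (induction k) (use run invariant_initial invariant_step in auto)
  have "card (pending (run k)) + k \<le> card (pending (run 0))" for k
  proof (induction k)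
    case (Suc k)
    then show ?case using invariant_step(2)[OF inv run(2), of k] by simp
  qed simp
  from this[of "Suc (card (pending (run 0)))"] show False by simp
qed

lemma step_exists:
  assumes "invariant st" "queue st \<noteq> {}"
  shows "\<exists>st'. rrm_step D r st st'"
proof -
  have "queue st \<subseteq> D \<times> D"
    using assms(1) by (auto simp: invariant_def sweep_invariant_def pending_def)
  then have fin: "finite (queue st)" using finite_D by (meson finite_SigmaI finite_subset)
  let ?f = "\<lambda>(a, b). crossing a b"
  have "Min (?f ` queue st) \<in> ?f ` queue st" using fin assms(2) by (intro Min_in) auto
  then obtain a b where ab: "(a, b) \<in> queue st" "crossing a b = Min (?f ` queue st)" by auto
  have "crossing a b \<le> ?f e" if "e \<in> queue st" for e
    unfolding ab(2) using fin that by (intro Min_le) auto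
  then have "\<forall>(a', b')\<in>queue st. crossing a b \<le> crossing a' b'" by fast
  then show ?thesis unfolding rrm_step_def using ab(1) by blast
qed

text \<open>By \<open>step_exists\<close> a run can only get stuck with an empty queue, and the
  number of pending pairs shows that this is reached.\<close>

lemma returns_exists: "\<exists>S. rrm_returns D r S"
proof -
  have "\<exists>st'. (rrm_step D r)\<^sup>*\<^sup>* st st' \<and> queue st' = {}" if "invariant st" for st
    using that
  proof (induction "card (pending st)" arbitrary: st rule: less_induct)
    case less
    show ?case
    proof (cases "queue st = {}")
      case False
      then obtain st1 where st1: "rrm_step D r st st1" using step_exists less by blast
      then show ?thesis using less invariant_step[OF less.prems st1] converse_rtranclp_into_rtranclp by metis
    qed auto
  qed
  then obtain st where st: "(rrm_step D r)\<^sup>*\<^sup>* (initial_state D) st" "queue st = {}"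
    using invariant_initial by blast
  let ?v = "\<lambda>t. snd (cells st (t, r))"
  have sky: "finite (skyline D)" "skyline D \<noteq> {}"
    using finite_subset[OF skyline_subset finite_D] skyline_nonempty[OF finite_D D_nonempty] by auto
  then have "Min (?v ` skyline D) \<in> ?v ` skyline D" by (intro Min_in) auto
  then obtain t where t: "t \<in> skyline D" "?v t = Min (?v ` skyline D)" by auto
  then have "\<forall>t'\<in>skyline D. ?v t \<le> ?v t'" using sky by simp
  then show ?thesis unfolding rrm_returns_def using st t(1) by blast
qed

text \<open>An empty queue leaves no adjacent inversion, and a list without adjacent inversions is
  sorted at 1.\<close>

lemma sorted_at_end:
  assumes "sweep_invariant st c" "queue st = {}"
  shows "sorted_at st 1"
proof (rule sorted_at_adjacent[OF assms(1)])
  fix s t assume st: "s \<in> D" "t \<in> D" "pos st t = Suc (pos st s)"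
  then have "(s, t) \<notin> pending st" using assms unfolding sweep_invariant_def by blast
  then show "dual_line t 1 \<le> dual_line s 1" using st by (simp add: pending_def)
qed

section \<open>Optimality of the returned set\<close>

lemma returns_optimal:
  assumes "rrm_returns D r S"
  shows "rrm_optimal D r S"
proof -
  obtain st t where st: "(rrm_step D r)\<^sup>*\<^sup>* (initial_state D) st" "queue st = {}" and t: "t \<in> skyline D"
      "\<And>t'. t' \<in> skyline D \<Longrightarrow> snd (cells st (t, r)) \<le> snd (cells st (t', r))"
      and S: "S = set (fst (cells st (t, r)))"
    using assms unfolding rrm_returns_def by blast
  have "invariant st" using invariant_reachable st by blast
  then obtain c where c: "sweep_invariant st c" "cells_sound st c" and complete: "cells_complete st"
    by (auto simp: invariant_def)
  \<comment> \<open>The sweep stops at some \<open>c < 1\<close>; the final list order carries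
    soundness over the rest of the interval.\<close>
  have "cells_sound st 1" using cells_sound_advance[OF c] sorted_at_end[OF c(1) st(2)] by simp
  then have cell: "t \<in> S" "S \<subseteq> D" "length (fst (cells st (t, r))) \<le> r" "enat (pos st t) \<le> snd (cells st (t, r))"
      "\<And>x. x \<in> {0..1} \<Longrightarrow> \<exists>s\<in>S. enat (line_rank D x s) \<le> snd (cells st (t, r))"
    using t(1) r_pos unfolding cells_sound_def S by auto
  have card: "card S \<le> r" unfolding S using cell(3) card_length order_trans by blast
  have le: "rank_regret D S \<le> rank_regret D S'" if S': "S' \<noteq> {}" "S' \<subseteq> D" "card S' \<le> r" for S'
  proof -
    obtain S'' where S'': "S'' \<subseteq> skyline D" "S'' \<noteq> {}" "card S'' \<le> card S'" "rank_regret D S'' \<le> rank_regret D S'"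
      using skyline_reduction[OF finite_D S'(2,1)] by blast
    have fin: "finite S''" using S''(1) skyline_subset finite_D finite_subset by metis
    then have "Min (pos st ` S'') \<in> pos st ` S''" using S'' by (intro Min_in) auto
    \<comment> \<open>The line \<open>p\<close> ends on top of \<open>S''\<close>. As
      \<open>S''\<close> has at most \<open>r\<close> members, column \<open>r\<close> admits all of
      them.\<close>
    then obtain p where p: "p \<in> S''" "pos st p = Min (pos st ` S'')" by auto
    then have top: "\<forall>s\<in>S''. pos st p \<le> pos st s" using fin by simp
    have "card {s\<in>S''. s $ 1 \<le> p $ 1} \<le> card S''" using fin by (intro card_mono) auto
    then have "snd (cells st (p, r)) \<le> enat (rank_regret D S'')"
      using complete S'' S' p top unfolding cells_complete_def by force
    \<comment> \<open>This uses the choice of \<open>t\<close> as a row of least value. In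
      particular the value of the returned cell is finite.\<close>
    then have v: "snd (cells st (t, r)) \<le> enat (rank_regret D S')"
      using t(2)[of p] p S'' by (meson enat_ord_simps(1) order_trans subsetD)
    show ?thesis
    proof (rule rank_regret_le[OF finite_D cell(2)])
      show "S \<noteq> {}" using cell by auto
      \<comment> \<open>Positions start at 1, so this settles the side condition of
        \<open>rank_regret_le\<close> that stems from the zero utility vector.\<close>
      have "enat (pos st t) \<le> enat (rank_regret D S')" using cell(4) v by (rule order_trans)
      then show "1 \<le> rank_regret D S'" by (simp add: position_def)
      fix x :: real assume "x \<in> {0..1}"
      then show "\<exists>s\<in>S. line_rank D x s \<le> rank_regret D S'"
        using cell(5) v by (meson enat_ord_simps(1) order_trans)
    qed
  qed
  let ?R = "{rank_regret D S' |S'. S' \<noteq> {} \<and> S' \<subseteq> D \<and> card S' \<le> r}"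
  have "?R \<subseteq> rank_regret D ` Pow D" by auto
  then have "finite ?R" using finite_D by (meson finite_Pow_iff finite_imageI finite_subset)
  then have "Min ?R = rank_regret D S" using cell card le by (intro Min_eqI) auto
  then show ?thesis unfolding rrm_optimal_def using cell card by auto
qed

end

theorem theorem4:
  fixes D :: "tuple set" and r :: nat
  assumes "dataset D" and "general_position D" and "r \<ge> 1"
  shows "rrm_terminates D r \<and> (\<exists>S. rrm_returns D r S) \<and>
         (\<forall>S. rrm_returns D r S \<longrightarrow> rrm_optimal D r S)"
proof -
  interpret rrm_input D r by unfold_locales (fact assms)+
  show ?thesis using terminates returns_exists returns_optimal by blast
qed

end
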